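(* Let $A>0$, $B>0$, $k\in\mathbb R\setminus\{0\}$, $S=A+B$, $R=A-B$, and for $\mu\in\mathbb C$ let $$F(\chi;\mu)=\mu\chi^3-2\chi^2+k^2(S-\mu)\chi+k^2(2-kR).$$ Suppose that for some $\mu_0\in\mathbb C$ the point $\chi_0\in\mathbb C$ is a triple root of $F(\chi;\mu_0)=0$, i.e. $F(\chi;\mu_0)=\mu_0(\chi-\chi_0)^3$. Then $$\mu_0=\frac{2}{3\chi_0},\qquad S=A+B=\frac{2\chi_0}{k^2}+\frac{2}{3\chi_0},\qquad R=A-B=\frac2k+\frac{2\chi_0^2}{3k^3}.$$ In particular $R\ne0$, so a triple root can occur only when $A\neq B$. Define $q_{\rm tri}=\chi_0/k$ and $\rho=R/S=(A-B)/(A+B)$. Then $$\rho=\frac{q_{\rm tri}(q_{\rm tri}^2+3)}{3q_{\rm tri}^2+1}.$$ The unique real solution of this equation in $(-1,1)$ is $$q_{\rm tri}=\tanh\left[\tfrac13\operatorname{arctanh}\left(\frac{A-B}{A+B}\right)\right],$$ and consequently $$k=\frac{2}{A+B}\left(q_{\rm tri}+\frac{1}{3q_{\rm tri}}\right),\qquad \chi_0=q_{\rm tri}k,\qquad \mu_0=\frac{2}{3\chi_0}.$$ The resulting triple root satisfies (is real with) $0<\chi_0<|k|$ and $\mu_0>0$, so that one may choose $\lambda_0=\sqrt{\mu_0}>0$ with $\lambda_0^2=\mu_0$. Conversely, for any $A,B>0$ with $A\ne B$, the parameters $q_{\rm tri}$, $k$, $\chi_0$, $\mu_0$ defined by the last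 two displays satisfy $F(\chi;\mu_0)=\mu_0(\chi-\chi_0)^3$. *)

theory Defs
  imports Complex_Main
begin

definition F :: "real \<Rightarrow> real \<Rightarrow> real \<Rightarrow> complex \<Rightarrow> complex \<Rightarrow> complex" where
  "F A B k \<mu> \<chi> =
     (let S = complex_of_real (A + B); R = complex_of_real (A - B); \<kappa> = complex_of_real k
      in \<mu> * \<chi> ^ 3 - 2 * \<chi> ^ 2 + \<kappa> ^ 2 * (S - \<mu>) * \<chi> + \<kappa> ^ 2 * (2 - \<kappa> * R))"

definition q_tri :: "real \<Rightarrow> real \<Rightarrow> real" where
  "q_tri A B = tanh (1 / 3 * artanh ((A - B) / (A + B)))"

(* The three parameters below are meaningful only for q_tri A B \<noteq> 0, i.e. A \<noteq> B. *)

definition k_tri :: "real \<Rightarrow> real \<Rightarrow> real" where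
  "k_tri A B = 2 / (A + B) * (q_tri A B + 1 / (3 * q_tri A B))"

definition \<chi>_tri :: "real \<Rightarrow> real \<Rightarrow> real" where
  "\<chi>_tri A B = q_tri A B * k_tri A B"

definition \<mu>_tri :: "real \<Rightarrow> real \<Rightarrow> real" where
  "\<mu>_tri A B = 2 / (3 * \<chi>_tri A B)"

end

theory Submission
  imports Defs
begin

text \<open>
  Comparing coefficients with \<^term>\<open>\<mu>\<^sub>0 * (\<chi> - \<chi>\<^sub>0) ^ 3\<close> gives \<open>\<mu>\<^sub>0 \<chi>\<^sub>0 = 2/3\<close> and then the
  formulas for \<open>S\<close> and \<open>R\<close>. The formula for \<open>R\<close> makes \<open>\<chi>\<^sub>0\<^sup>2\<close> real, so \<open>\<chi>\<^sub>0\<close> is real or imaginary;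
  since \<open>S\<close> is real and positive, \<open>\<chi>\<^sub>0\<close> is real and positive. With \<open>q = \<chi>\<^sub>0/k\<close> the quotient
  \<open>\<rho> = R/S\<close> is given by the triplication formula \<open>\<rho> = q (q\<^sup>2 + 3) / (3 q\<^sup>2 + 1)\<close> of \<open>tanh\<close>.
  The identities \<open>1 \<mp> \<rho> = (1 \<mp> q)\<^sup>3 / (3 q\<^sup>2 + 1)\<close> and \<open>\<bar>\<rho>\<bar> < 1\<close> force \<open>\<bar>q\<bar> < 1\<close>, so \<open>q\<close> is itself
  a \<open>tanh\<close> and its argument is a third of \<open>artanh \<rho>\<close>.
\<close>

section \<open>The triplication formula of \<open>tanh\<close> and its inversion on (-1, 1)\<close>

lemma tanh_artanh_real:
  fixes x :: real
  assumes "\<bar>x\<bar> < 1"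
  shows "tanh (artanh x) = x"
proof -
  \<comment> \<open>\<open>artanh x\<close> is half the logarithm of this quotient; positivity is
    what lets \<open>exp\<close> undo \<open>ln\<close>.\<close>
  have pos: "(1 + x) / (1 - x) > 0"
    using assms by auto
  have "exp (- 2 * artanh x) = inverse ((1 + x) / (1 - x))"
    using pos by (simp add: artanh_def exp_minus)
  also have "\<dots> = (1 - x) / (1 + x)" by simp
  finally have "exp (- 2 * artanh x) = (1 - x) / (1 + x)" .
  then have "tanh (artanh x) = (1 - (1 - x) / (1 + x)) / (1 + (1 - x) / (1 + x))"
    by (simp add: tanh_real_altdef)
  also have "\<dots> = x"
  proof -
    have "1 + x \<noteq> 0" using assms by auto
    then have "1 - (1 - x) / (1 + x) = 2 * x / (1 + x)" "1 + (1 - x) / (1 + x) = 2 / (1 + x)"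
      by (simp_all add: field_simps)
    with \<open>1 + x \<noteq> 0\<close> show ?thesis by simp
  qed
  finally show ?thesis .
qed

lemma tanh_triple:
  fixes y :: real
  shows "tanh (3 * y) = tanh y * (tanh y ^ 2 + 3) / (3 * tanh y ^ 2 + 1)"
proof -
  have c: "cosh z \<noteq> 0" for z :: real using cosh_real_pos[of z] by simp
  have p: "1 + t ^ 2 > 0" for t :: real
    by (simp add: add_pos_nonneg)
  define t where "t = tanh y"
  have "tanh (2 * y) = 2 * t / (1 + t ^ 2)"
    using tanh_add[OF c c, of y y] by (simp add: t_def power2_eq_square)
  then have "tanh (3 * y) = (2 * t / (1 + t ^ 2) + t) / (1 + 2 * t / (1 + t ^ 2) * t)"
    using tanh_add[OF c c, of "2 * y" y] by (simp add: t_def)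
  also have "\<dots> = ((2 * t + t * (1 + t ^ 2)) / (1 + t ^ 2)) / ((1 + t ^ 2 + 2 * t * t) / (1 + t ^ 2))"
    using p[of t] by (simp add: add_divide_distrib)
  also have "\<dots> = (2 * t + t * (1 + t ^ 2)) / (1 + t ^ 2 + 2 * t * t)"
    using p[of t] by simp
  also have "\<dots> = t * (t ^ 2 + 3) / (3 * t ^ 2 + 1)"
    by (simp add: algebra_simps power2_eq_square)
  finally show ?thesis by (simp add: t_def)
qed

text \<open>Every q in (-1, 1) is \<open>tanh y\<close> with \<open>y = artanh q\<close>, and by
  \<open>tanh_triple\<close> the equation then reads \<open>r = tanh (3 * y)\<close>. Applying
  \<open>artanh\<close> gives \<open>3 * y = artanh r\<close>, hence uniqueness; reading this
  backwards gives existence.\<close>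

lemma triplication_eq_iff:
  fixes r q :: real
  assumes r: "\<bar>r\<bar> < 1"
  shows "(\<bar>q\<bar> < 1 \<and> r = q * (q ^ 2 + 3) / (3 * q ^ 2 + 1)) \<longleftrightarrow> q = tanh (1 / 3 * artanh r)"
proof
  assume q: "\<bar>q\<bar> < 1 \<and> r = q * (q ^ 2 + 3) / (3 * q ^ 2 + 1)"
  then have "r = tanh (3 * artanh q)"
    by (simp add: tanh_triple tanh_artanh_real)
  then have "artanh r = 3 * artanh q" by (simp add: artanh_tanh_real)
  with q show "q = tanh (1 / 3 * artanh r)" by (simp add: tanh_artanh_real)
next
  assume q: "q = tanh (1 / 3 * artanh r)"
  have "r = tanh (3 * (1 / 3 * artanh r))"
    using r by (simp add: tanh_artanh_real)
  then show "\<bar>q\<bar> < 1 \<and> r = q * (q ^ 2 + 3) / (3 * q ^ 2 + 1)"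
    unfolding tanh_triple q[symmetric] using tanh_real_bounds[of "1 / 3 * artanh r"] q by auto
qed

text \<open>By the binomial formula (1 - q)^3 and (1 + q)^3 equal (3q^2 + 1) - q(q^2 + 3) and (3q^2
  + 1) + q(q^2 + 3). The hypothesis makes both positive, and an odd power is positive only if its
  base is.\<close>

lemma abs_less_1_of_triplication:
  fixes q :: real
  assumes "\<bar>q * (q ^ 2 + 3) / (3 * q ^ 2 + 1)\<bar> < 1"
  shows "\<bar>q\<bar> < 1"
proof -
  have d: "3 * q ^ 2 + 1 > 0" by (simp add: add_nonneg_pos)
  have "\<bar>q * (q ^ 2 + 3)\<bar> < 3 * q ^ 2 + 1"
    using assms d by (simp add: abs_divide)
  then have "(1 - q) ^ 3 > 0" "(1 + q) ^ 3 > 0"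
    by (auto simp: abs_less_iff algebra_simps power2_eq_square power3_eq_cube)
  then show ?thesis by (auto simp: zero_less_power_eq)
qed

section \<open>Coefficient comparison, reality of the root and normalization by k\<close>

lemma F_triple_root_iff:
  "(\<forall>\<chi>. F A B k \<mu> \<chi> = \<mu> * (\<chi> - c) ^ 3) \<longleftrightarrow>
     3 * \<mu> * c = 2 \<and>
     of_real k ^ 2 * (of_real (A + B) - \<mu>) = 3 * \<mu> * c ^ 2 \<and>
     of_real k ^ 2 * (2 - of_real k * of_real (A - B)) = - \<mu> * c ^ 3"
  (is "?L \<longleftrightarrow> ?p \<and> ?q \<and> ?r")
proof
  assume L: ?L
  define b where "b = complex_of_real k ^ 2 * (of_real (A + B) - \<mu>)"
  define d where "d = complex_of_real k ^ 2 * (2 - of_real k * of_real (A - B))"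
  have *: "\<mu> * x ^ 3 - 2 * x ^ 2 + b * x + d = \<mu> * (x - c) ^ 3" for x
    using L unfolding F_def Let_def b_def d_def by blast
  \<comment> \<open>Both sides of \<open>*\<close> have leading term \<mu> x^3, so their difference
    has degree at most 2 and the values at 0, 1 and -1 determine its coefficients.\<close>
  have 0: "d = - \<mu> * c ^ 3" using *[of 0] by simp
  have 1: "\<mu> - 2 + b + d = \<mu> * (1 - c) ^ 3" using *[of 1] by simp
  have 2: "- \<mu> - 2 - b + d = \<mu> * (-1 - c) ^ 3" using *[of "-1"] by simp
  have p: ?p using 0 1 2 by algebra
  moreover have "b = 3 * \<mu> * c ^ 2" using 0 1 2 by algebra
  ultimately show "?p \<and> ?q \<and> ?r" using 0 by (simp add: b_def d_def)
next
  assume "?p \<and> ?q \<and> ?r"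
  then have p: "2 = 3 * \<mu> * c" and q: ?q and r: ?r by simp_all
  show ?L
  proof
    fix \<chi>
    have "F A B k \<mu> \<chi> = \<mu> * \<chi> ^ 3 - (3 * \<mu> * c) * \<chi> ^ 2 + 3 * \<mu> * c ^ 2 * \<chi> + - \<mu> * c ^ 3"
      unfolding F_def Let_def q r p[symmetric] ..
    then show "F A B k \<mu> \<chi> = \<mu> * (\<chi> - c) ^ 3"
      by (simp add: algebra_simps power2_eq_square power3_eq_cube)
  qed
qed

lemma triple_root_real:
  fixes k S R :: real and c :: complex
  assumes "k \<noteq> 0" "S > 0" "c \<noteq> 0"
    and S: "of_real S = 2 * c / of_real k ^ 2 + 2 / (3 * c)"
    and R: "of_real R = 2 / of_real k + 2 * c ^ 2 / (3 * of_real k ^ 3)"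
  obtains x where "c = of_real x" "x > 0"
proof -
  have "c ^ 2 = of_real ((R - 2 / k) * 3 * k ^ 3 / 2)"
    using R assms(1) by (simp add: field_simps)
  then have "Im (c ^ 2) = 0" by (metis Im_complex_of_real)
  \<comment> \<open>Im (c^2) = 2 Re c Im c.\<close>
  then have ri: "Re c = 0 \<or> Im c = 0" by (auto simp: power2_eq_square)
  have "S = 2 * Re c / k ^ 2 + Re (2 / (3 * c))"
    using arg_cong[OF S, of Re] by (simp flip: of_real_power)
  also have "Re (2 / (3 * c)) = 2 * Re c / (3 * (cmod c) ^ 2)"
  proof -
    have "2 / (3 * c) = of_real (2 / 3) * inverse c" by (simp add: field_simps)
    also have "Re \<dots> = 2 / 3 * Re (inverse c)" by (simp only: Re_complex_of_real Im_complex_of_real times_complex.sel mult_zero_left diff_zero)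
    finally show ?thesis by (simp add: cmod_power2)
  qed
  \<comment> \<open>The bracket is positive, so Re c has the sign of S; this excludes the imaginary
    axis and negative c.\<close>
  finally have e: "S = Re c * (2 / k ^ 2 + 2 / (3 * (cmod c) ^ 2))"
    by (simp add: algebra_simps)
  have "2 / k ^ 2 + 2 / (3 * (cmod c) ^ 2) > 0"
    using assms(1,3) by (simp add: add_pos_pos)
  with e \<open>S > 0\<close> have "Re c > 0" by (simp add: zero_less_mult_iff)
  with ri have "c = of_real (Re c)" by (simp add: complex_eq_iff)
  with \<open>Re c > 0\<close> that show thesis by blast
qed

text \<open>Substituting x = qk turns both S and R into 1/k times a function of q alone. Hence k
  cancels in R / S, and the formula for S can be solved for k.\<close>

lemma triple_root_normalized:
  fixes k S R x q :: real
  assumes k: "k \<noteq> 0" and x: "x > 0"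
    and S: "S = 2 * x / k ^ 2 + 2 / (3 * x)"
    and R: "R = 2 / k + 2 * x ^ 2 / (3 * k ^ 3)"
    and q: "q = x / k"
  shows "R \<noteq> 0" "R / S = q * (q ^ 2 + 3) / (3 * q ^ 2 + 1)" "k = 2 / S * (q + 1 / (3 * q))"
proof -
  have q0: "q \<noteq> 0" and xq: "x = q * k" using k x q by auto
  have p: "q ^ 2 + 3 > 0" "3 * q ^ 2 + 1 > 0"
    by (simp_all add: add_nonneg_pos)
  have S': "S = 2 * (3 * q ^ 2 + 1) / (3 * q * k)"
    unfolding S xq using k q0 by (simp add: field_simps power2_eq_square)
  have R': "R = 2 * (q ^ 2 + 3) / (3 * k)"
    unfolding R xq using k by (simp add: field_simps power2_eq_square power3_eq_cube)
  show "R \<noteq> 0" unfolding R' using p k by simp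
  show "R / S = q * (q ^ 2 + 3) / (3 * q ^ 2 + 1)"
    proof -
    have "(2 * a / (3 * k)) / (2 * b / (3 * q * k)) = q * a / b" if "b \<noteq> 0" for a b
      using that k q0 by (simp add: field_simps)
    from this[of "3 * q ^ 2 + 1" "q ^ 2 + 3"] show ?thesis
      unfolding R' S' using p(2) by linarith
  qed
  have "2 / S = 3 * q * k / (3 * q ^ 2 + 1)" unfolding S' divide_divide_eq_right
    by (metis mult_divide_mult_cancel_left zero_neq_numeral)
  moreover have "q + 1 / (3 * q) = (3 * q ^ 2 + 1) / (3 * q)"
    using q0 by (simp add: field_simps power2_eq_square)
  ultimately show "k = 2 / S * (q + 1 / (3 * q))"
    using p q0 by simp
qed

section \<open>Necessity and sufficiency for given positive A and B\<close>

lemma abs_ratio_less_1: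
  fixes A B :: real
  assumes "A > 0" "B > 0"
  shows "\<bar>(A - B) / (A + B)\<bar> < 1"
  using assms by (auto simp: abs_less_iff field_simps)

lemma q_tri_iff:
  assumes "A > 0" "B > 0"
  shows "\<bar>q\<bar> < 1 \<and> (A - B) / (A + B) = q * (q ^ 2 + 3) / (3 * q ^ 2 + 1) \<longleftrightarrow> q = q_tri A B"
  unfolding q_tri_def by (rule triplication_eq_iff[OF abs_ratio_less_1[OF assms]])

lemma triple_root_necessary:
  fixes A B k :: real and \<mu> c :: complex
  assumes AB: "A > 0" "B > 0" and k: "k \<noteq> 0"
    and F: "\<And>\<chi>. F A B k \<mu> \<chi> = \<mu> * (\<chi> - c) ^ 3"
  obtains x where "c = of_real x" "0 < x" "x < \<bar>k\<bar>" "\<mu> = of_real (2 / (3 * x))"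
    "A + B = 2 * x / k ^ 2 + 2 / (3 * x)" "A - B = 2 / k + 2 * x ^ 2 / (3 * k ^ 3)"
    "A - B \<noteq> 0" "x / k = q_tri A B" "k = k_tri A B"
proof -
  have *: "3 * \<mu> * c = 2"
    "of_real k ^ 2 * (of_real (A + B) - \<mu>) = 3 * \<mu> * c ^ 2"
    "of_real k ^ 2 * (2 - of_real k * of_real (A - B)) = - \<mu> * c ^ 3"
    using F F_triple_root_iff[of A B k \<mu> c] by blast+
  then have c: "c \<noteq> 0" by auto
  with *(1) have \<mu>: "\<mu> = 2 / (3 * c)" by (simp add: field_simps)
  have \<kappa>: "complex_of_real k \<noteq> 0" using k by simp
  have "of_real k ^ 2 * (of_real (A + B) - \<mu>) = 2 * c"
    unfolding *(2) using *(1) by (simp add: power2_eq_square flip: mult.assoc)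
  then have "of_real (A + B) - \<mu> = 2 * c / of_real k ^ 2"
    using \<kappa> by (simp add: field_simps)
  then have S: "of_real (A + B) = 2 * c / of_real k ^ 2 + 2 / (3 * c)"
    using \<mu> by (simp add: algebra_simps)
  \<comment> \<open>The factor 3 makes 3 \<mu> c appear on the right, so that its value 2 eliminates
    \<mu>.\<close>
  have "3 * of_real k ^ 2 * (2 - of_real k * of_real (A - B)) = - 2 * c ^ 2"
  proof -
    have "3 * of_real k ^ 2 * (2 - of_real k * of_real (A - B)) = - (3 * \<mu> * c) * c ^ 2"
      using *(3) by (simp add: power2_eq_square power3_eq_cube mult.assoc)
    then show ?thesis unfolding *(1) by simp
  qed
  then have "3 * of_real k ^ 3 * of_real (A - B) = 6 * of_real k ^ 2 + 2 * c ^ 2"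
    by algebra
  then have "of_real (A - B) = (6 * of_real k ^ 2 + 2 * c ^ 2) / (3 * of_real k ^ 3)"
    using \<kappa> by (simp add: field_simps)
  also have "\<dots> = 2 / of_real k + 2 * c ^ 2 / (3 * of_real k ^ 3)"
    using \<kappa> by (simp add: add_divide_distrib power2_eq_square power3_eq_cube)
  finally have R: "of_real (A - B) = 2 / of_real k + 2 * c ^ 2 / (3 * of_real k ^ 3)" .
  obtain x where x: "c = of_real x" "x > 0"
    using triple_root_real[OF k _ c S R] AB by auto
  have "complex_of_real (A + B) = of_real (2 * x / k ^ 2 + 2 / (3 * x))"
    unfolding S x by simp
  then have S': "A + B = 2 * x / k ^ 2 + 2 / (3 * x)" by (simp only: of_real_eq_iff)
  have "complex_of_real (A - B) = of_real (2 / k + 2 * x ^ 2 / (3 * k ^ 3))"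
    unfolding R x by simp
  then have R': "A - B = 2 / k + 2 * x ^ 2 / (3 * k ^ 3)" by (simp only: of_real_eq_iff)
  note n = triple_root_normalized[OF k x(2) S' R' refl]
  have q1: "\<bar>x / k\<bar> < 1"
    using abs_ratio_less_1[OF AB] unfolding n(2) by (rule abs_less_1_of_triplication)
  with n(2) have q: "x / k = q_tri A B" using q_tri_iff[OF AB] by blast
  have "x < \<bar>k\<bar>" using q1 k x(2) by (simp add: abs_divide)
  moreover have "k = k_tri A B" using n(3) unfolding k_tri_def q .
  moreover have "\<mu> = of_real (2 / (3 * x))" unfolding \<mu> x by simp
  ultimately show thesis using that x S' R' n(1) q by blast
qed

lemma triple_root_sufficient:
  fixes A B :: real
  assumes AB: "A > 0" "B > 0" "A \<noteq> B"
  shows "q_tri A B \<noteq> 0" "k_tri A B \<noteq> 0" "\<chi>_tri A B \<noteq> 0"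
    "F A B (k_tri A B) (of_real (\<mu>_tri A B)) \<chi> = of_real (\<mu>_tri A B) * (\<chi> - of_real (\<chi>_tri A B)) ^ 3"
proof -
  define q where "q = q_tri A B"
  define k where "k = k_tri A B"
  define S where "S = A + B"
  have S: "S > 0" using AB by (simp add: S_def)
  have e: "(A - B) / S = q * (q ^ 2 + 3) / (3 * q ^ 2 + 1)"
    using q_tri_iff[OF AB(1,2), of q] by (simp add: q_def S_def)
  have p: "3 * q ^ 2 + 1 > 0" by (simp add: add_nonneg_pos)
  \<comment> \<open>If q were 0, the ratio in \<open>e\<close> would vanish and A would equal
    B.\<close>
  have q0: "q \<noteq> 0" using e S AB(3) by auto
  have k: "k = 2 * (3 * q ^ 2 + 1) / (3 * q * S)"
    unfolding k_def k_tri_def q_def[symmetric] S_def[symmetric]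
    using q0 S by (simp add: field_simps power2_eq_square)
  have k0: "k \<noteq> 0" unfolding k using p q0 S by simp
  have c: "\<chi>_tri A B = q * k" by (simp add: \<chi>_tri_def q_def k_def)
  define m where "m = \<mu>_tri A B"
  have m: "3 * m * (q * k) = 2"
    using q0 k0 by (simp add: m_def \<mu>_tri_def c)
  \<comment> \<open>\<open>kS\<close> and \<open>kR\<close> are the denominator-free forms of the
    formulas \<open>S'\<close> and \<open>R'\<close> in \<open>triple_root_normalized\<close>; the
    coefficient identities follow from them and \<open>m\<close>.\<close>
  have kS: "3 * q * S * k = 2 * (3 * q ^ 2 + 1)"
    unfolding k using q0 S by simp
  have "(A - B) * (3 * q ^ 2 + 1) = S * q * (q ^ 2 + 3)"
    using e S p by (simp add: field_simps)
  then have "3 * k * (A - B) * (3 * q ^ 2 + 1) = 2 * (q ^ 2 + 3) * (3 * q ^ 2 + 1)"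
    using kS by algebra
  then have kR: "3 * k * (A - B) = 2 * (q ^ 2 + 3)" using p by simp
  \<comment> \<open>The nonzero factor 3q produces the left-hand sides of \<open>kS\<close> and
    \<open>m\<close>; it is cancelled afterwards.\<close>
  have "3 * q * (k ^ 2 * (S - m)) = 3 * q * (3 * m * (q * k) ^ 2)"
  proof -
    have "3 * q * (k ^ 2 * (S - m)) = k * (3 * q * S * k) - k * (3 * m * (q * k))"
      by (simp add: algebra_simps power2_eq_square)
    also have "\<dots> = 3 * q ^ 2 * k * 2"
      unfolding m kS by (simp add: algebra_simps)
    also have "\<dots> = 3 * q * (3 * m * (q * k) ^ 2)"
      unfolding m[symmetric] by (simp add: algebra_simps power2_eq_square)
    finally show ?thesis .
  qed
  then have 2: "k ^ 2 * (S - m) = 3 * m * (q * k) ^ 2"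
    using q0 mult_left_cancel[of "3 * q"] by fastforce
  have 3: "k ^ 2 * (2 - k * (A - B)) = - m * (q * k) ^ 3"
  proof -
    have "3 * (k ^ 2 * (2 - k * (A - B))) = 3 * (- m * (q * k) ^ 3)"
    proof -
      have "3 * (k ^ 2 * (2 - k * (A - B))) = 6 * k ^ 2 - k ^ 2 * (3 * k * (A - B))"
        by (simp add: algebra_simps)
      also have "\<dots> = - 2 * (q * k) ^ 2"
        unfolding kR by (simp add: algebra_simps power_mult_distrib)
      also have "\<dots> = 3 * (- m * (q * k) ^ 3)"
        unfolding m[symmetric] by (simp add: power2_eq_square power3_eq_cube)
      finally show ?thesis .
    qed
    then show ?thesis by simp
  qed
  show "q_tri A B \<noteq> 0" "k_tri A B \<noteq> 0" "\<chi>_tri A B \<noteq> 0"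
    using q0 k0 c by (auto simp: q_def k_def)
  \<comment> \<open>The three real identities are carried over to the complex numbers, as
    \<open>F_triple_root_iff\<close> requires.\<close>
  have "3 * complex_of_real m * of_real (q * k) = 2"
    using arg_cong[OF m, of complex_of_real] by simp
  moreover have "of_real k ^ 2 * (of_real (A + B) - of_real m) = 3 * complex_of_real m * of_real (q * k) ^ 2"
    using arg_cong[OF 2, of complex_of_real] by (simp add: S_def)
  moreover have "of_real k ^ 2 * (2 - of_real k * of_real (A - B)) = - complex_of_real m * of_real (q * k) ^ 3"
    using arg_cong[OF 3, of complex_of_real] by simp
  ultimately show "F A B (k_tri A B) (of_real (\<mu>_tri A B)) \<chi>
      = of_real (\<mu>_tri A B) * (\<chi> - of_real (\<chi>_tri A B)) ^ 3"
    unfolding c m_def[symmetric] k_def[symmetric]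
    using F_triple_root_iff[of A B k "of_real m" "of_real (q * k)"] by blast
qed

theorem theorem12:
  fixes A B :: real
  assumes "A > 0" and "B > 0"
  shows
    "(\<forall>(k::real) (\<mu>\<^sub>0::complex) (\<chi>\<^sub>0::complex).
        k \<noteq> 0 \<longrightarrow> (\<forall>\<chi>. F A B k \<mu>\<^sub>0 \<chi> = \<mu>\<^sub>0 * (\<chi> - \<chi>\<^sub>0) ^ 3) \<longrightarrow>
        (let S = A + B; R = A - B; \<rho> = R / S; \<kappa> = complex_of_real k; q = \<chi>\<^sub>0 / \<kappa>
         in \<chi>\<^sub>0 \<noteq> 0 \<and>
            \<mu>\<^sub>0 = 2 / (3 * \<chi>\<^sub>0) \<and>
            complex_of_real S = 2 * \<chi>\<^sub>0 / \<kappa> ^ 2 + 2 / (3 * \<chi>\<^sub>0) \<and>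
            complex_of_real R = 2 / \<kappa> + 2 * \<chi>\<^sub>0 ^ 2 / (3 * \<kappa> ^ 3) \<and>
            R \<noteq> 0 \<and> A \<noteq> B \<and>
            3 * q ^ 2 + 1 \<noteq> 0 \<and>
            complex_of_real \<rho> = q * (q ^ 2 + 3) / (3 * q ^ 2 + 1) \<and>
            q = complex_of_real (q_tri A B) \<and>
            k = k_tri A B \<and>
            \<chi>\<^sub>0 = complex_of_real (q_tri A B * k) \<and>
            \<chi>\<^sub>0 \<in> \<real> \<and> 0 < Re \<chi>\<^sub>0 \<and> Re \<chi>\<^sub>0 < \<bar>k\<bar> \<and>
            \<mu>\<^sub>0 \<in> \<real> \<and> 0 < Re \<mu>\<^sub>0 \<and>
            (let lam\<^sub>0 = sqrt (Re \<mu>\<^sub>0) in lam\<^sub>0 > 0 \<and> complex_of_real lam\<^sub>0 ^ 2 = \<mu>\<^sub>0)))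
     \<and> (\<forall>q::real. (-1 < q \<and> q < 1 \<and> (A - B) / (A + B) = q * (q ^ 2 + 3) / (3 * q ^ 2 + 1))
          \<longleftrightarrow> q = q_tri A B)
     \<and> (A \<noteq> B \<longrightarrow>
          q_tri A B \<noteq> 0 \<and> k_tri A B \<noteq> 0 \<and> \<chi>_tri A B \<noteq> 0 \<and>
          (\<forall>\<chi>. F A B (k_tri A B) (complex_of_real (\<mu>_tri A B)) \<chi> =
               complex_of_real (\<mu>_tri A B) * (\<chi> - complex_of_real (\<chi>_tri A B)) ^ 3))"
proof (intro conjI allI impI, goal_cases)
  case (1 k \<mu>\<^sub>0 \<chi>\<^sub>0)
  from 1(2) obtain x where x: "\<chi>\<^sub>0 = of_real x" "0 < x" "x < \<bar>k\<bar>"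
    and \<mu>: "\<mu>\<^sub>0 = of_real (2 / (3 * x))"
    and S: "A + B = 2 * x / k ^ 2 + 2 / (3 * x)"
    and R: "A - B = 2 / k + 2 * x ^ 2 / (3 * k ^ 3)" "A - B \<noteq> 0"
    and q: "x / k = q_tri A B" and k: "k = k_tri A B"
    using triple_root_necessary[OF assms 1(1)] by metis
  have q': "\<chi>\<^sub>0 / of_real k = of_real (q_tri A B)" by (simp add: x flip: q)
  have xq: "x = q_tri A B * k" using 1(1) by (simp flip: q)
  have p: "3 * q_tri A B ^ 2 + 1 > 0" by (simp add: add_nonneg_pos)
  \<comment> \<open>Over the complex numbers 3q^2 + 1 has the zeros i/sqrt 3 and -i/sqrt 3, so this
    rests on q being real.\<close>
  have "complex_of_real (3 * q_tri A B ^ 2 + 1) \<noteq> 0"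
    unfolding of_real_eq_0_iff using p by simp
  then have d: "3 * complex_of_real (q_tri A B) ^ 2 + 1 \<noteq> 0" by simp
  have \<rho>: "(A - B) / (A + B)
      = q_tri A B * (q_tri A B ^ 2 + 3) / (3 * q_tri A B ^ 2 + 1)"
    using q_tri_iff[OF assms] by blast
  have \<rho>': "complex_of_real ((A - B) / (A + B))
      = of_real (q_tri A B) * (of_real (q_tri A B) ^ 2 + 3) / (3 * of_real (q_tri A B) ^ 2 + 1)"
    unfolding \<rho> by simp
  have S': "complex_of_real (A + B) = 2 * \<chi>\<^sub>0 / of_real k ^ 2 + 2 / (3 * \<chi>\<^sub>0)"
    unfolding S x by simp
  have R': "complex_of_real (A - B) = 2 / of_real k + 2 * \<chi>\<^sub>0 ^ 2 / (3 * of_real k ^ 3)"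
    unfolding R(1) x by simp
  have l: "complex_of_real (sqrt (Re \<mu>\<^sub>0)) ^ 2 = \<mu>\<^sub>0" "0 < Re \<mu>\<^sub>0"
    using x(2) by (simp_all add: \<mu> del: of_real_divide flip: of_real_power)
  show ?case
    unfolding Let_def q'
    using x \<mu> R(2) k d \<rho>' S' R' l xq by (intro conjI) (auto simp del: of_real_add of_real_diff)
next
  case (2 q)
  show ?case using q_tri_iff[OF assms, of q] by (auto simp: abs_less_iff)
qed (use triple_root_sufficient[OF assms] in blast)+

end
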